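(* Let $n\ge 1$ and let $S$ be an $n$-element set. All chordal AC algorithms on $S$ have the same complexity distribution, i.e. for every $i\ge 0$, the number of set partitions of $S$ on which the algorithm uses exactly $i$ queries is the same for all chordal AC algorithms.
   Context: Setting. $S$ is a finite set of items carrying an unknown set partition $P$. An AC (active clustering) algorithm repeatedly asks an oracle whether two items lie in the same block of $P$; the choice of each query may depend on earlier answers. Aggregated graphs: $G_0$ is the edgeless graph on $S$ (each vertex labelled by itself); each query concerns two distinct non-adjacent vertices $x,y$ of the current aggregated graph $G_t$. A negative answer adds the edge $xy$; a positive answer merges $x$ and $y$ into one vertex adjacent to all neighbours of $x$ and $y$, labelled by the union of their labels. The algorithm stops when the aggregated graph is complete. The complexity on $P$ is the number of queries; the complexity distribution is the tuple $(a_0,a_1,\dots)$ where $a_i$ is the number of partitions of $S$ with complexity $i$. An AC algorithm is chordal if for every input partition every aggregated graph is chordal (all induced cycles have length $3$). *)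

theory Defs
  imports Main "HOL-Library.Disjoint_Sets"
begin

section \<open>Simple graphs\<close>

text \<open>Edges are unordered pairs, that is, two-element sets of vertices.\<close>

record 'v ugraph =
  verts :: "'v set"
  edges :: "'v set set"

definition complete_graph :: "'v ugraph \<Rightarrow> bool" where
  "complete_graph G \<longleftrightarrow>
     (\<forall>x\<in>verts G. \<forall>y\<in>verts G. x \<noteq> y \<longrightarrow> {x, y} \<in> edges G)"

definition cycle_edges :: "'v list \<Rightarrow> 'v set set" where
  "cycle_edges c = {{c ! i, c ! (Suc i mod length c)} | i. i < length c}"

definition induced_cycle :: "'v ugraph \<Rightarrow> 'v list \<Rightarrow> bool" where
  "induced_cycle G c \<longleftrightarrow>
     3 \<le> length c \<and> distinct c \<and> set c \<subseteq> verts G \<and>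
     {e \<in> edges G. e \<subseteq> set c} = cycle_edges c"

definition chordal_graph :: "'v ugraph \<Rightarrow> bool" where
  "chordal_graph G \<longleftrightarrow> (\<forall>c. induced_cycle G c \<longrightarrow> length c = 3)"

section \<open>Aggregated graphs\<close>

text \<open>
  Labels of distinct vertices are disjoint, so a vertex is identified with its label,
  a set of items.
\<close>

type_synonym 'a agg_graph = "'a set ugraph"

definition initial_graph :: "'a set \<Rightarrow> 'a agg_graph" where
  "initial_graph S = \<lparr>verts = (\<lambda>s. {s}) ` S, edges = {}\<rparr>"

definition add_edge :: "'a set \<Rightarrow> 'a set \<Rightarrow> 'a agg_graph \<Rightarrow> 'a agg_graph" where
  "add_edge x y G = \<lparr>verts = verts G, edges = insert {x, y} (edges G)\<rparr>"

definition merge :: "'a set \<Rightarrow> 'a set \<Rightarrow> 'a agg_graph \<Rightarrow> 'a agg_graph" where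
  "merge x y G =
     \<lparr>verts = insert (x \<union> y) (verts G - {x, y}),
      edges = {e \<in> edges G. x \<notin> e \<and> y \<notin> e} \<union>
              {{x \<union> y, z} | z. z \<in> verts G - {x, y} \<and>
                               ({x, z} \<in> edges G \<or> {y, z} \<in> edges G)}\<rparr>"

section \<open>Active clustering algorithms\<close>

text \<open>
  A deterministic adaptive algorithm is a binary decision tree. In \<open>Query x y N Y\<close> the
  vertices \<open>x\<close> and \<open>y\<close> of the current aggregated graph are queried, and the
  algorithm continues with \<open>N\<close> after a negative and with \<open>Y\<close> after a positive
  answer. Every query joins or merges two non-adjacent vertices, so no algorithm on a
  finite set has an infinite run and finite trees suffice.
\<close>

datatype 'a ac_tree = Stop | Query "'a set" "'a set" "'a ac_tree" "'a ac_tree"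

fun admissible :: "'a agg_graph \<Rightarrow> 'a ac_tree \<Rightarrow> bool" where
  "admissible G Stop \<longleftrightarrow> complete_graph G"
| "admissible G (Query x y N Y) \<longleftrightarrow>
     x \<in> verts G \<and> y \<in> verts G \<and> x \<noteq> y \<and> {x, y} \<notin> edges G \<and>
     admissible (add_edge x y G) N \<and> admissible (merge x y G) Y"

definition ac_algorithm :: "'a set \<Rightarrow> 'a ac_tree \<Rightarrow> bool" where
  "ac_algorithm S T \<longleftrightarrow> admissible (initial_graph S) T"

text \<open>
  A query asks about two items, one from each queried vertex. During a run on
  \<open>P\<close> the items of a single vertex lie in a common block of \<open>P\<close>, so the answer does not
  depend on the representatives: it is positive iff one block contains both labels.
\<close>

definition same_block :: "'a set set \<Rightarrow> 'a set \<Rightarrow> 'a set \<Rightarrow> bool" where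
  "same_block P x y \<longleftrightarrow> (\<exists>B\<in>P. x \<subseteq> B \<and> y \<subseteq> B)"

fun run :: "'a set set \<Rightarrow> 'a agg_graph \<Rightarrow> 'a ac_tree \<Rightarrow> 'a agg_graph list" where
  "run P G Stop = [G]"
| "run P G (Query x y N Y) =
     G # (if same_block P x y then run P (merge x y G) Y else run P (add_edge x y G) N)"

fun complexity :: "'a set set \<Rightarrow> 'a ac_tree \<Rightarrow> nat" where
  "complexity P Stop = 0"
| "complexity P (Query x y N Y) =
     Suc (if same_block P x y then complexity P Y else complexity P N)"

definition complexity_distribution :: "'a set \<Rightarrow> 'a ac_tree \<Rightarrow> nat \<Rightarrow> nat" where
  "complexity_distribution S T i = card {P. partition_on S P \<and> complexity P T = i}"

definition chordal_algorithm :: "'a set \<Rightarrow> 'a ac_tree \<Rightarrow> bool" where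
  "chordal_algorithm S T \<longleftrightarrow> ac_algorithm S T \<and>
     (\<forall>P. partition_on S P \<longrightarrow>
        (\<forall>G \<in> set (run P (initial_graph S) T). chordal_graph G))"

end

theory Submission
  imports Defs Complex_Main "HOL-Library.Multiset"
begin

text \<open>
  To a chordal graph $G$ belongs a multiset $D$ of naturals, the numbers of later neighbours
  in a perfect elimination ordering; it is determined by the clique counts, since $G$ has
  $\sum_{d \in D} \binom{d}{k}$ cliques of size $k+1$. Let $x, y$ be queried in $G$ and let
  $c$ be the number of their common neighbours. If $G$ and $G + xy$ are chordal, counting
  cliques shows that the multisets of $G$, $G + xy$ and $G/xy$ are $R \cup \{c\}$,
  $R \cup \{c+1\}$ and $R$ for some $R$. The generating function of the complexity satisfies
  $F_G = q (F_{G+xy} + F_{G/xy})$ with $F = 1$ on complete graphs, and a function of $D$ alone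
  satisfies the same recursion, so $F_G$ depends only on the clique counts of $G$.
\<close>

section \<open>Aggregated graphs as simple graphs on a partition of the items\<close>

text \<open>The invariant kept along every run. Disjoint nonempty labels let a vertex be recovered
  from any of its items, and distinct endpoints exclude loops, which would appear as singleton
  edges.\<close>

definition agg_graph :: "'a set \<Rightarrow> 'a agg_graph \<Rightarrow> bool" where
  "agg_graph S G \<longleftrightarrow> partition_on S (verts G) \<and>
     (\<forall>e\<in>edges G. \<exists>u\<in>verts G. \<exists>v\<in>verts G. u \<noteq> v \<and> e = {u, v})"

definition cliques :: "'v ugraph \<Rightarrow> nat \<Rightarrow> 'v set set" where
  "cliques G k = {K. K \<subseteq> verts G \<and> card K = k \<and>
     (\<forall>u\<in>K. \<forall>v\<in>K. u \<noteq> v \<longrightarrow> {u, v} \<in> edges G)}"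

definition nbrs :: "'v ugraph \<Rightarrow> 'v \<Rightarrow> 'v set" where
  "nbrs G x = {z \<in> verts G. {x, z} \<in> edges G}"

lemma add_edge_simps [simp]:
  "verts (add_edge x y G) = verts G"
  "edges (add_edge x y G) = insert {x, y} (edges G)"
  by (simp_all add: add_edge_def)

lemma partition_block_eq:
  assumes "partition_on S P" "B \<in> P" "B' \<in> P" "b \<in> B" "b \<in> B'"
  shows "B = B'"
  using assms unfolding partition_on_def disjoint_def by blast

lemma partition_block_nonempty:
  assumes "partition_on S P" "B \<in> P"
  obtains b where "b \<in> B" "b \<in> S"
  using assms unfolding partition_on_def by (metis UnionI ex_in_conv)

lemma partition_block_of:
  assumes "partition_on S P" "b \<in> S"
  obtains B where "B \<in> P" "b \<in> B"
  using assms unfolding partition_on_def by blast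

lemma agg_graph_partition: "agg_graph S G \<Longrightarrow> partition_on S (verts G)"
  by (simp add: agg_graph_def)

lemma agg_graph_edgeE:
  assumes "agg_graph S G" "e \<in> edges G"
  obtains u v where "u \<in> verts G" "v \<in> verts G" "u \<noteq> v" "e = {u, v}"
  using assms unfolding agg_graph_def by metis

lemma agg_graph_edgeD:
  assumes "agg_graph S G" "{u, v} \<in> edges G"
  shows "u \<in> verts G" "v \<in> verts G" "u \<noteq> v"
proof -
  from assms obtain a b where "a \<in> verts G" "b \<in> verts G" "a \<noteq> b" "{u, v} = {a, b}"
    by (rule agg_graph_edgeE)
  then show "u \<in> verts G" "v \<in> verts G" "u \<noteq> v" by (auto simp: doubleton_eq_iff)
qed

lemma agg_graph_no_loop: "agg_graph S G \<Longrightarrow> {u} \<notin> edges G"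
  using agg_graph_edgeD(3)[of S G u u] by auto

lemma agg_graph_initial: "agg_graph S (initial_graph S)"
  unfolding agg_graph_def initial_graph_def partition_on_def disjoint_def by auto

lemma agg_graph_add_edge:
  assumes "agg_graph S G" "x \<in> verts G" "y \<in> verts G" "x \<noteq> y"
  shows "agg_graph S (add_edge x y G)"
  using assms unfolding agg_graph_def by auto

context
  fixes S :: "'a set" and G :: "'a agg_graph" and x y :: "'a set"
  assumes G: "agg_graph S G" and x: "x \<in> verts G" and y: "y \<in> verts G" and xy: "x \<noteq> y"
begin

text \<open>Blocks that share an item are equal, so a vertex \<open>x \<union> y\<close> would
  coincide with both \<open>x\<close> and \<open>y\<close>. Hence the vertex created by a merge
  never collides with an old one.\<close>

lemma union_notin_verts: "x \<union> y \<notin> verts G"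
proof
  assume "x \<union> y \<in> verts G"
  note V = agg_graph_partition[OF G]
  obtain a b where "a \<in> x" "b \<in> y"
    using partition_block_nonempty[OF V x] partition_block_nonempty[OF V y] by metis
  with \<open>x \<union> y \<in> verts G\<close> have "x = x \<union> y" "y = x \<union> y"
    using partition_block_eq[OF V] x y by blast+
  with xy show False by simp
qed

lemma agg_graph_merge: "agg_graph S (merge x y G)"
proof -
  note V = agg_graph_partition[OF G]
  have "partition_on S (insert (x \<union> y) (verts G - {x, y}))"
  proof (rule partition_onI)
    show "\<Union> (insert (x \<union> y) (verts G - {x, y})) = S"
      using partition_onD1[OF V] x y by auto
    show "disjnt p q" if "p \<in> insert (x \<union> y) (verts G - {x, y})"
      "q \<in> insert (x \<union> y) (verts G - {x, y})" "p \<noteq> q" for p q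
      using that partition_block_eq[OF V] x y unfolding disjnt_iff by blast
    show "{} \<notin> insert (x \<union> y) (verts G - {x, y})"
      using partition_onD3[OF V] x y by auto
  qed
  moreover have "\<exists>u\<in>verts (merge x y G). \<exists>v\<in>verts (merge x y G). u \<noteq> v \<and> e = {u, v}"
    if e: "e \<in> edges (merge x y G)" for e
  proof (cases "e \<in> edges G \<and> x \<notin> e \<and> y \<notin> e")
    case True
    then have "e \<in> edges G" by blast
    with G obtain u v where uv: "u \<in> verts G" "v \<in> verts G" "u \<noteq> v" "e = {u, v}"
      by (rule agg_graph_edgeE)
    with True have "u \<in> verts (merge x y G)" "v \<in> verts (merge x y G)"
      by (auto simp: merge_def)
    with uv(3,4) show ?thesis by blast
  next
    case False
    with e obtain z where z: "e = {x \<union> y, z}" "z \<in> verts G - {x, y}"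
      by (auto simp: merge_def)
    then have "x \<union> y \<in> verts (merge x y G)" "z \<in> verts (merge x y G)" "x \<union> y \<noteq> z"
      using union_notin_verts by (auto simp: merge_def)
    with z(1) show ?thesis by (intro bexI conjI)
  qed
  ultimately show ?thesis by (auto simp: agg_graph_def merge_def)
qed

end


subsection \<open>Cliques\<close>

text \<open>Edges have distinct endpoints, so \<open>a \<noteq> c\<close> and
  \<open>b \<noteq> d\<close> already make the four vertices distinct; without a chord they form an
  induced cycle of length 4. Chordality is applied below in this form, to squares through both
  queried vertices.\<close>

lemma chordal_no_square:
  assumes G: "agg_graph S G" and ch: "chordal_graph G"
    and e: "{a, b} \<in> edges G" "{b, c} \<in> edges G" "{c, d} \<in> edges G" "{d, a} \<in> edges G"
    and ac: "a \<noteq> c" and bd: "b \<noteq> d"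
  shows "{a, c} \<in> edges G \<or> {b, d} \<in> edges G"
proof (rule ccontr)
  assume n: "\<not> ?thesis"
  note ab = agg_graph_edgeD[OF G e(1)] agg_graph_edgeD[OF G e(2)]
    agg_graph_edgeD[OF G e(3)] agg_graph_edgeD[OF G e(4)]
  let ?c = "[a, b, c, d]"
  have "cycle_edges ?c = (\<lambda>i. {?c ! i, ?c ! (Suc i mod length ?c)}) ` {i. i < length ?c}"
    unfolding cycle_edges_def by (rule setcompr_eq_image)
  also have "{i. i < length ?c} = {0, 1, 2, 3}" by auto
  also have "(\<lambda>i. {?c ! i, ?c ! (Suc i mod length ?c)}) ` {0, 1, 2, 3} = {{a, b}, {b, c}, {c, d}, {d, a}}"
    by simp
  finally have cyc: "cycle_edges ?c = {{a, b}, {b, c}, {c, d}, {d, a}}" .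
  have sub: "e \<in> {{a, b}, {b, c}, {c, d}, {d, a}}" if "e \<in> edges G" "e \<subseteq> set ?c" for e
  proof -
    from G that(1) obtain u v where uv: "u \<noteq> v" "e = {u, v}"
      by (rule agg_graph_edgeE)
    with that have u: "u \<in> {a, b, c, d}" and v: "v \<in> {a, b, c, d}" and e: "{u, v} \<in> edges G"
      by auto
    have n': "{a, c} \<notin> edges G" "{c, a} \<notin> edges G" "{b, d} \<notin> edges G" "{d, b} \<notin> edges G"
      using n by (simp_all add: insert_commute)
    from u v show ?thesis
      unfolding uv(2) by (elim insertE emptyE) (use uv(1) e n' in \<open>simp_all add: doubleton_eq_iff\<close>)
  qed
  have "{f \<in> edges G. f \<subseteq> set ?c} = {{a, b}, {b, c}, {c, d}, {d, a}}"
  proof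
    show "{f \<in> edges G. f \<subseteq> set ?c} \<subseteq> {{a, b}, {b, c}, {c, d}, {d, a}}"
    proof
      fix f assume "f \<in> {f \<in> edges G. f \<subseteq> set ?c}"
      then show "f \<in> {{a, b}, {b, c}, {c, d}, {d, a}}" using sub[of f] by (simp only: mem_Collect_eq)
    qed
    show "{{a, b}, {b, c}, {c, d}, {d, a}} \<subseteq> {f \<in> edges G. f \<subseteq> set ?c}"
      using e by simp
  qed
  moreover have "distinct ?c" "set ?c \<subseteq> verts G"
    using ab ac bd by auto
  ultimately have "induced_cycle G ?c"
    by (simp add: induced_cycle_def cyc)
  with ch have "length ?c = 3" unfolding chordal_graph_def by blast
  then show False by simp
qed

lemma finite_cliques: "finite (verts G) \<Longrightarrow> finite (cliques G k)"
  by (rule finite_subset[of _ "Pow (verts G)"]) (auto simp: cliques_def)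

section \<open>Effect of a query on the clique counts\<close>

context
  fixes S :: "'a set" and G :: "'a agg_graph" and x y :: "'a set"
  assumes fin: "finite (verts G)" and G: "agg_graph S G"
    and x: "x \<in> verts G" and y: "y \<in> verts G" and xy: "x \<noteq> y"
    and nonadj: "{x, y} \<notin> edges G"
    and chordal: "chordal_graph G"
begin

abbreviation (input) "common_nbrs \<equiv> nbrs G x \<inter> nbrs G y"

text \<open>The vertices \<open>x, u, y, v\<close> form a square whose diagonal
  \<open>{x, y}\<close> is missing, which leaves \<open>{u, v}\<close>. So every set of common
  neighbours is a clique, and binomial coefficients count these cliques.\<close>

lemma common_nbrs_clique:
  assumes "u \<in> common_nbrs" "v \<in> common_nbrs" "u \<noteq> v"
  shows "{u, v} \<in> edges G"
proof -
  have "{x, u} \<in> edges G" "{u, y} \<in> edges G" "{y, v} \<in> edges G" "{v, x} \<in> edges G"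
    using assms by (auto simp: nbrs_def insert_commute)
  from chordal_no_square[OF G chordal this xy assms(3)] nonadj show ?thesis by blast
qed

lemma notin_nbrs: "x \<notin> nbrs G x" "y \<notin> nbrs G y" "y \<notin> nbrs G x" "x \<notin> nbrs G y"
  using agg_graph_no_loop[OF G] nonadj by (auto simp: nbrs_def insert_commute)

lemma finite_nbrs: "finite (nbrs G z)"
  using fin by (simp add: nbrs_def)

lemma card_cliques_containing:
  assumes "z \<in> verts G"
  shows "card {K \<in> cliques G (Suc k). z \<in> K} = card {L \<in> cliques G k. L \<subseteq> nbrs G z}"
proof -
  have z: "z \<notin> nbrs G z" using agg_graph_no_loop[OF G] by (auto simp: nbrs_def)
  have "bij_betw (insert z) {L \<in> cliques G k. L \<subseteq> nbrs G z} {K \<in> cliques G (Suc k). z \<in> K}"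
  proof (rule bij_betw_byWitness[where f' = "\<lambda>K. K - {z}"])
    show "insert z ` {L \<in> cliques G k. L \<subseteq> nbrs G z} \<subseteq> {K \<in> cliques G (Suc k). z \<in> K}"
    proof clarify
      fix L assume L: "L \<in> cliques G k" "L \<subseteq> nbrs G z"
      then have "finite L" "z \<notin> L" using finite_nbrs z finite_subset by blast+
      with L assms show "insert z L \<in> cliques G (Suc k) \<and> z \<in> insert z L"
        by (auto simp: cliques_def nbrs_def insert_commute)
    qed
    show "(\<lambda>K. K - {z}) ` {K \<in> cliques G (Suc k). z \<in> K} \<subseteq> {L \<in> cliques G k. L \<subseteq> nbrs G z}"
      by (auto simp: cliques_def nbrs_def)
  qed (use z in auto)
  then show ?thesis by (simp add: bij_betw_same_card)
qed

text \<open>A new clique consists of \<open>x\<close>, \<open>y\<close> and \<open>k - 1\<close>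
  common neighbours, and every such choice gives a clique. Pascal's rule writes their number as the
  difference of two binomials, the form in which an element \<open>c\<close> of the degree multiset
  is replaced by \<open>c + 1\<close>.\<close>

lemma card_cliques_add_edge:
  "card (cliques (add_edge x y G) (Suc k)) + (card common_nbrs choose k)
     = card (cliques G (Suc k)) + (Suc (card common_nbrs) choose k)"
proof -
  let ?A = "add_edge x y G"
  let ?N = "{K \<in> cliques ?A (Suc k). x \<in> K \<and> y \<in> K}"
  have "cliques ?A (Suc k) = cliques G (Suc k) \<union> ?N"
    by (auto simp: cliques_def doubleton_eq_iff)
  moreover have "card (cliques G (Suc k) \<union> ?N) = card (cliques G (Suc k)) + card ?N"
    using finite_cliques[of G] finite_cliques[of ?A] fin xy nonadj
    by (intro card_Un_disjoint) (auto simp: cliques_def)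
  ultimately have *: "card (cliques ?A (Suc k)) = card (cliques G (Suc k)) + card ?N"
    by simp
  show ?thesis
  proof (cases k)
    \<comment> \<open>A clique with one vertex cannot contain both \<open>x\<close> and
      \<open>y\<close>, and both binomial coefficients are 1.\<close>
    case 0
    have "K \<notin> ?N" for K
      using xy 0 by (auto simp: cliques_def card_Suc_eq)
    then have "?N = {}" by blast
    with * have "card (cliques ?A (Suc k)) = card (cliques G (Suc k))"
      by (simp only: card.empty add_0_right)
    with 0 show ?thesis by simp
  next
    case (Suc j)
    have "bij_betw (\<lambda>L. insert x (insert y L)) {L. L \<subseteq> common_nbrs \<and> card L = j} ?N"
    proof (rule bij_betw_byWitness[where f' = "\<lambda>K. K - {x, y}"])
      show "(\<lambda>L. insert x (insert y L)) ` {L. L \<subseteq> common_nbrs \<and> card L = j} \<subseteq> ?N"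
      proof clarify
        fix L assume L: "L \<subseteq> common_nbrs" "j = card L"
        then have "finite L" "x \<notin> L" "y \<notin> L"
          using finite_nbrs notin_nbrs finite_subset by blast+
        moreover have "u \<in> verts G" "{x, u} \<in> edges G" "{y, u} \<in> edges G"
          "{u, x} \<in> edges G" "{u, y} \<in> edges G" if "u \<in> L" for u
          using that L by (auto simp: nbrs_def insert_commute)
        moreover have "{u, v} \<in> edges G" if "u \<in> L" "v \<in> L" "u \<noteq> v" for u v
          using that L common_nbrs_clique by blast
        ultimately show "insert x (insert y L) \<in> cliques ?A (Suc k) \<and>
            x \<in> insert x (insert y L) \<and> y \<in> insert x (insert y L)"
          using x y xy Suc L by (auto simp: cliques_def insert_commute)
      qed
      show "(\<lambda>K. K - {x, y}) ` ?N \<subseteq> {L. L \<subseteq> common_nbrs \<and> card L = j}"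
      proof clarify
        fix K assume K: "K \<in> cliques ?A (Suc k)" "x \<in> K" "y \<in> K"
        have "card (K - {x, y}) = j"
          using K xy Suc by (simp add: cliques_def card_Diff_subset)
        moreover have "K - {x, y} \<subseteq> common_nbrs"
        proof
          fix u assume u: "u \<in> K - {x, y}"
          with K have "{x, u} \<in> edges ?A" "{y, u} \<in> edges ?A" "u \<in> verts ?A"
            unfolding cliques_def by blast+
          with u xy show "u \<in> common_nbrs" by (auto simp: nbrs_def doubleton_eq_iff)
        qed
        ultimately show "K - {x, y} \<subseteq> common_nbrs \<and> card (K - {x, y}) = j" by blast
      qed
    qed (use notin_nbrs in auto)
    then have "card ?N = card {L. L \<subseteq> common_nbrs \<and> card L = j}"
      by (simp add: bij_betw_same_card)
    also have "\<dots> = card common_nbrs choose j"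
      by (rule n_subsets) (simp add: finite_nbrs)
    finally show ?thesis using * Suc by simp
  qed
qed

text \<open>Cliques avoiding \<open>x\<close> and \<open>y\<close> survive the merge. No clique of
  \<open>G\<close> contains both, so the others number \<open>card (?A x) + card (?A y)\<close>. In
  the merged graph those through the new vertex correspond to \<open>?A x \<union> ?A y\<close>. The
  loss is therefore the size of \<open>?A x \<inter> ?A y\<close>.\<close>

lemma card_cliques_merge:
  assumes chordal_add: "chordal_graph (add_edge x y G)"
  shows "card (cliques G (Suc k)) = card (cliques (merge x y G) (Suc k)) + (card common_nbrs choose k)"
proof -
  let ?M = "merge x y G"
  let ?A = "\<lambda>z. {L \<in> cliques G k. L \<subseteq> nbrs G z}"
  let ?U = "{K \<in> cliques G (Suc k). x \<notin> K \<and> y \<notin> K}"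
  have xyG: "x \<union> y \<notin> verts G" by (rule union_notin_verts[OF G x y xy])
  have finA: "finite (?A z)" "finite ?U" "finite (cliques ?M (Suc k))" for z
    using finite_cliques[OF fin] finite_cliques[of ?M] fin by (auto simp: merge_def)
  have edge_M: "{u, v} \<in> edges ?M \<longleftrightarrow> {u, v} \<in> edges G"
    if "u \<in> verts G - {x, y}" "v \<in> verts G - {x, y}" for u v
    using that xyG by (auto simp: merge_def doubleton_eq_iff)
  have edge_M': "{x \<union> y, v} \<in> edges ?M \<longleftrightarrow> v \<in> nbrs G x \<or> v \<in> nbrs G y"
    if "v \<in> verts G - {x, y}" for v
    using that xyG agg_graph_edgeD[OF G] by (auto simp: merge_def doubleton_eq_iff nbrs_def)

  have "cliques G (Suc k) = ?U \<union> ({K \<in> cliques G (Suc k). x \<in> K} \<union> {K \<in> cliques G (Suc k). y \<in> K})"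
    by auto
  moreover have "{K \<in> cliques G (Suc k). x \<in> K} \<inter> {K \<in> cliques G (Suc k). y \<in> K} = {}"
    using xy nonadj by (auto simp: cliques_def)
  ultimately have cG: "card (cliques G (Suc k)) = card ?U + (card (?A x) + card (?A y))"
    using finite_cliques[OF fin] card_cliques_containing[OF x] card_cliques_containing[OF y]
    by (subst \<open>cliques G (Suc k) = _\<close>) (subst card_Un_disjoint; auto simp: card_Un_disjoint)+

  have "{K \<in> cliques ?M (Suc k). x \<union> y \<notin> K} = ?U"
  proof (intro set_eqI iffI)
    fix K assume "K \<in> {K \<in> cliques ?M (Suc k). x \<union> y \<notin> K}"
    then have K: "K \<subseteq> verts G - {x, y}" "card K = Suc k"
      "\<And>u v. u \<in> K \<Longrightarrow> v \<in> K \<Longrightarrow> u \<noteq> v \<Longrightarrow> {u, v} \<in> edges ?M"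
      by (auto simp: cliques_def merge_def)
    with edge_M show "K \<in> ?U" unfolding cliques_def by blast
  next
    fix K assume "K \<in> ?U"
    then have K: "K \<subseteq> verts G - {x, y}" "card K = Suc k"
      "\<And>u v. u \<in> K \<Longrightarrow> v \<in> K \<Longrightarrow> u \<noteq> v \<Longrightarrow> {u, v} \<in> edges G"
      by (auto simp: cliques_def)
    then have "\<And>u v. u \<in> K \<Longrightarrow> v \<in> K \<Longrightarrow> u \<noteq> v \<Longrightarrow> {u, v} \<in> edges ?M"
      using edge_M by blast
    with K xyG show "K \<in> {K \<in> cliques ?M (Suc k). x \<union> y \<notin> K}"
      by (auto simp: cliques_def merge_def)
  qed
  moreover have "card {K \<in> cliques ?M (Suc k). x \<union> y \<in> K} = card (?A x \<union> ?A y)"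
  proof -
    have sub: "L \<subseteq> verts G - {x, y} \<and> x \<union> y \<notin> L \<and> finite L" if "L \<in> ?A x \<union> ?A y" for L
      using that notin_nbrs xyG fin by (auto simp: cliques_def intro: finite_subset)
    have "bij_betw (insert (x \<union> y)) (?A x \<union> ?A y) {K \<in> cliques ?M (Suc k). x \<union> y \<in> K}"
    proof (rule bij_betw_byWitness[where f' = "\<lambda>K. K - {x \<union> y}"])
      show "insert (x \<union> y) ` (?A x \<union> ?A y) \<subseteq> {K \<in> cliques ?M (Suc k). x \<union> y \<in> K}"
      proof (rule image_subsetI)
        fix L assume L: "L \<in> ?A x \<union> ?A y"
        note s = sub[OF L]
        have "{u, v} \<in> edges ?M" if "u \<in> L" "v \<in> L" "u \<noteq> v" for u v
          using edge_M[of u v] that s L unfolding cliques_def by blast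
        moreover have "{x \<union> y, v} \<in> edges ?M" if "v \<in> L" for v
          using edge_M'[of v] that s L by blast
        ultimately show "insert (x \<union> y) L \<in> {K \<in> cliques ?M (Suc k). x \<union> y \<in> K}"
          using s L by (auto simp: cliques_def merge_def insert_commute)
      qed
      show "(\<lambda>K. K - {x \<union> y}) ` {K \<in> cliques ?M (Suc k). x \<union> y \<in> K} \<subseteq> ?A x \<union> ?A y"
      proof (rule image_subsetI)
        fix K assume "K \<in> {K \<in> cliques ?M (Suc k). x \<union> y \<in> K}"
        then have K: "K \<subseteq> verts ?M" "card K = Suc k" "x \<union> y \<in> K"
          "\<And>u v. u \<in> K \<Longrightarrow> v \<in> K \<Longrightarrow> u \<noteq> v \<Longrightarrow> {u, v} \<in> edges ?M"
          by (auto simp: cliques_def)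
        let ?L = "K - {x \<union> y}"
        have L: "?L \<subseteq> verts G - {x, y}" using K by (auto simp: merge_def)
        have Le: "{u, v} \<in> edges G" if "u \<in> ?L" "v \<in> ?L" "u \<noteq> v" for u v
          using edge_M[of u v] that K L by blast
        have Ln: "u \<in> nbrs G x \<or> u \<in> nbrs G y" if "u \<in> ?L" for u
          using edge_M'[of u] that K L by blast
        have "?L \<in> cliques G k"
          using L Le K unfolding cliques_def by auto
        \<comment> \<open>Here chordality after the negative answer enters: if \<open>u\<close> is
          adjacent only to \<open>x\<close> and \<open>v\<close> only to \<open>y\<close>, then
          \<open>x, u, v, y\<close> is a square closed by the new edge, with neither diagonal
          present.\<close>
        moreover have "?L \<subseteq> nbrs G x \<or> ?L \<subseteq> nbrs G y"
        proof (rule ccontr)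
          assume "\<not> ?thesis"
          then obtain u v where uv: "u \<in> ?L" "v \<in> ?L" "u \<notin> nbrs G y" "v \<notin> nbrs G x"
            by blast
          with Ln have uv': "u \<in> nbrs G x" "v \<in> nbrs G y" "u \<noteq> v" by blast+
          have ne: "x \<noteq> v" "u \<noteq> y" using uv L by auto
          have "{x, u} \<in> edges (add_edge x y G)" "{u, v} \<in> edges (add_edge x y G)"
            "{v, y} \<in> edges (add_edge x y G)" "{y, x} \<in> edges (add_edge x y G)"
            using uv uv' Le by (auto simp: nbrs_def insert_commute)
          from chordal_no_square[OF agg_graph_add_edge[OF G x y xy] chordal_add this ne]
          have "{x, v} = {x, y} \<or> {x, v} \<in> edges G \<or> {u, y} = {x, y} \<or> {y, u} \<in> edges G"
            by (simp add: insert_commute)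
          moreover have "u \<in> verts G" "v \<in> verts G" "u \<noteq> x" "v \<noteq> y"
            using L uv(1,2) by blast+
          ultimately show False
            using uv(3,4) xy by (simp add: nbrs_def doubleton_eq_iff)
        qed
        ultimately show "?L \<in> ?A x \<union> ?A y" by blast
      qed
    qed (use sub in auto)
    then show ?thesis by (simp add: bij_betw_same_card)
  qed
  moreover have "cliques ?M (Suc k) = {K \<in> cliques ?M (Suc k). x \<union> y \<notin> K} \<union> {K \<in> cliques ?M (Suc k). x \<union> y \<in> K}"
    by auto
  ultimately have cM: "card (cliques ?M (Suc k)) = card ?U + card (?A x \<union> ?A y)"
    using finA by (metis (no_types, lifting) card_Un_disjoint disjoint_iff finite_Un mem_Collect_eq)
  have "?A x \<inter> ?A y = {L. L \<subseteq> common_nbrs \<and> card L = k}"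
    using common_nbrs_clique by (auto simp: cliques_def nbrs_def)
  moreover have "finite common_nbrs" using finite_nbrs by blast
  ultimately have "card (?A x \<inter> ?A y) = card common_nbrs choose k"
    by (simp only: n_subsets)
  with cG cM card_Un_Int[OF finA(1) finA(1), of x y] show ?thesis by simp
qed

end

lemma card_cliques_complete:
  assumes "finite (verts G)" "complete_graph G"
  shows "card (cliques G k) = card (verts G) choose k"
proof -
  have "cliques G k = {K. K \<subseteq> verts G \<and> card K = k}"
    using assms(2) unfolding cliques_def complete_graph_def by blast
  with assms(1) show ?thesis by (simp add: n_subsets)
qed


subsection \<open>Multisets of degrees\<close>

definition binom_sum :: "nat multiset \<Rightarrow> nat \<Rightarrow> nat" where
  "binom_sum D k = (\<Sum>d\<in>#D. d choose k)"

lemma binom_sum_simps [simp]: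
  "binom_sum {#} k = 0"
  "binom_sum (add_mset d D) k = (d choose k) + binom_sum D k"
  "binom_sum (D + E) k = binom_sum D k + binom_sum E k"
  by (simp_all add: binom_sum_def)

lemma binom_sum_replicate: "binom_sum (replicate_mset n d) k = n * (d choose k)"
  by (induction n) simp_all

text \<open>The system is triangular: \<open>d choose N\<close> is 0 for \<open>d < N\<close> and 1
  for \<open>d = N\<close>, so if no element exceeds \<open>N\<close>, the sum at \<open>N\<close>
  is the multiplicity of \<open>N\<close>. Removing these copies lowers the bound.\<close>

lemma binom_sum_inject:
  assumes "\<And>k. binom_sum D k = binom_sum E k"
  shows "D = E"
proof -
  have "\<forall>d\<in>#D + E. d < N \<Longrightarrow> (\<And>k. binom_sum D k = binom_sum E k) \<Longrightarrow> D = E" for N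
  proof (induction N arbitrary: D E)
    case 0
    then show ?case by (metis multi_nonempty_split not_less_zero union_iff union_single_eq_member)
  next
    case (Suc N)
    let ?low = "filter_mset (\<lambda>d. d < N)"
    have split: "F = ?low F + replicate_mset (count F N) N" if "\<forall>d\<in>#F. d < Suc N" for F
    proof (rule multiset_eqI)
      fix d
      have "count F d = 0" if "N < d"
        using that \<open>\<forall>d\<in>#F. d < Suc N\<close> by (metis count_eq_zero_iff less_Suc_eq not_less_iff_gr_or_eq)
      then show "count F d = count (?low F + replicate_mset (count F N) N) d"
        by (cases d N rule: linorder_cases) auto
    qed
    have low0: "binom_sum (?low F) N = 0" for F
      unfolding binom_sum_def by (induction F) auto
    have D: "D = ?low D + replicate_mset (count D N) N"
      and E: "E = ?low E + replicate_mset (count E N) N"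
      using Suc.prems(1) by (intro split; simp)+
    have "binom_sum F N = count F N" if "F = ?low F + replicate_mset (count F N) N" for F
      by (subst that) (simp add: low0 binom_sum_replicate)
    with D E Suc.prems(2)[of N] have c: "count D N = count E N" by simp
    have "binom_sum (?low D) k = binom_sum (?low E) k" for k
    proof -
      have "binom_sum (?low D) k + binom_sum (replicate_mset (count D N) N) k = binom_sum D k"
        by (subst (3) D) simp
      moreover have "binom_sum (?low E) k + binom_sum (replicate_mset (count E N) N) k = binom_sum E k"
        by (subst (3) E) simp
      ultimately show ?thesis using c Suc.prems(2)[of k] by simp
    qed
    then have "?low D = ?low E" by (intro Suc.IH) auto
    with D E c show ?case by metis
  qed
  \<comment> \<open>The added 0 keeps the maximum meaningful when both multisets are empty.\<close>
  from this[of "Suc (Max_mset (add_mset 0 (D + E)))"] assms show ?thesis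
    by (auto simp: less_Suc_eq_le)
qed

text \<open>The hockey-stick identity; the numbers below \<open>n\<close> form the degree multiset
  of the complete graph on \<open>n\<close> vertices.\<close>

lemma binom_sum_upt: "binom_sum (mset [0..<n]) k = n choose Suc k"
  by (induction n) simp_all


subsection \<open>The generating function of a multiset of degrees\<close>

text \<open>The summand for \<open>i\<close> is the weight of the event that comparison number
  \<open>i + 1\<close> is the first positive one.\<close>

definition qint :: "real \<Rightarrow> nat \<Rightarrow> real" where
  "qint q k = (\<Sum>i<k. q ^ Suc i)"

text \<open>
  If \<open>f k\<close> is the generating function of the future cost with \<open>k\<close> pairwise
  separated blocks, then \<open>insert_op q d f k\<close> is the one when a new item, already known
  to lie outside \<open>d\<close> of the \<open>k\<close> blocks, is first compared with the other
  \<open>k - d\<close> one by one. The formula extends this to \<open>k < d\<close> so that the operators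
  for different \<open>d\<close> commute.
\<close>

definition insert_op :: "real \<Rightarrow> nat \<Rightarrow> (nat \<Rightarrow> real) \<Rightarrow> nat \<Rightarrow> real" where
  "insert_op q d f k = ((qint q k - qint q d) * f k + q ^ k * f (Suc k)) / q ^ d"

text \<open>The argument is the number of blocks present before the items of \<open>D\<close> are
  inserted. The constant 1 stands for no further cost once all are inserted.\<close>

definition gen_fun :: "real \<Rightarrow> nat multiset \<Rightarrow> nat \<Rightarrow> real" where
  "gen_fun q D = fold_mset (insert_op q) (\<lambda>_. 1) D"

text \<open>In both compositions \<open>f k\<close>, \<open>f (k+1)\<close> and
  \<open>f (k+2)\<close> have, up to the factor \<open>1 / q^(d+e)\<close>, the coefficients
  \<open>([k]-[d])([k]-[e])\<close>, \<open>q^k([k]+[k+1]-[d]-[e])\<close> and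
  \<open>q^(2k+1)\<close>, where \<open>[k]\<close> is \<open>qint q k\<close>. They are symmetric
  in \<open>d\<close> and \<open>e\<close>, so the fold is independent of the order.\<close>

lemma comp_fun_commute_insert_op: "comp_fun_commute (insert_op q)"
proof
  fix d e
  show "insert_op q d \<circ> insert_op q e = insert_op q e \<circ> insert_op q d"
  proof (intro ext)
    fix f k
    show "(insert_op q d \<circ> insert_op q e) f k = (insert_op q e \<circ> insert_op q d) f k"
      by (simp add: insert_op_def add_divide_distrib[symmetric] mult.commute algebra_simps)
  qed
qed

lemma gen_fun_add_mset: "gen_fun q (add_mset d D) = insert_op q d (gen_fun q D)"
  unfolding gen_fun_def
  by (rule comp_fun_commute.fold_mset_add_mset[OF comp_fun_commute_insert_op])

text \<open>Since \<open>qint q (Suc c) = qint q c + q ^ Suc c\<close>, passing from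
  \<open>c\<close> to \<open>Suc c\<close> and multiplying by \<open>q\<close> loses exactly
  \<open>q * gen_fun q D k\<close>, the share of a positive answer.\<close>

lemma gen_fun_query:
  assumes "q > 0"
  shows "gen_fun q (add_mset c D) k
    = q * (gen_fun q (add_mset (Suc c) D) k + gen_fun q D k)"
  using assms by (simp add: gen_fun_add_mset insert_op_def qint_def field_simps)

text \<open>For \<open>d = k\<close> the first coefficient of \<open>insert_op\<close> vanishes and
  the powers of \<open>q\<close> cancel: the item opens a new block at no cost, and \<open>j\<close>
  moves to \<open>Suc j\<close>. At \<open>j = 0\<close> this is the complete graph.\<close>

lemma gen_fun_upt:
  assumes "q > 0" "j \<le> n"
  shows "gen_fun q (mset [j..<n]) j = 1"
  using assms(2)
proof (induction rule: inc_induct)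
  case base
  then show ?case by (simp add: gen_fun_def)
next
  case (step j)
  then have "mset [j..<n] = add_mset j (mset [Suc j..<n])" by (simp add: upt_rec)
  with step assms(1) show ?case by (simp add: gen_fun_add_mset insert_op_def)
qed


subsection \<open>Partitions compatible with an aggregated graph\<close>

text \<open>The inputs consistent with the answers recorded in \<open>G\<close>: merged labels
  record positive answers, edges negative ones.\<close>

definition compatible :: "'a set \<Rightarrow> 'a agg_graph \<Rightarrow> 'a set set set" where
  "compatible S G = {P. partition_on S P \<and> (\<forall>v\<in>verts G. \<exists>B\<in>P. v \<subseteq> B) \<and>
     (\<forall>u v. {u, v} \<in> edges G \<longrightarrow> \<not> same_block P u v)}"

lemma finite_compatible: "finite S \<Longrightarrow> finite (compatible S G)"
  by (rule finite_subset[of _ "Pow (Pow S)"]) (auto simp: compatible_def partition_on_def)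

lemma compatible_initial: "compatible S (initial_graph S) = {P. partition_on S P}"
  by (auto simp: compatible_def initial_graph_def partition_on_def)

lemma same_block_verts:
  assumes "partition_on S V" "u \<in> V" "v \<in> V" "same_block V u v"
  shows "u = v"
proof -
  from assms(4) obtain B where B: "B \<in> V" "u \<subseteq> B" "v \<subseteq> B" by (auto simp: same_block_def)
  have "u = B" "v = B"
    using assms B unfolding partition_on_def disjoint_def by (metis inf.absorb1)+
  then show ?thesis by simp
qed

text \<open>The finest compatible partition; it shows that some input is always left.\<close>

lemma verts_compatible:
  assumes "agg_graph S G"
  shows "verts G \<in> compatible S G"
proof -
  have V: "partition_on S (verts G)" using assms by (simp add: agg_graph_def)
  have "\<not> same_block (verts G) u v" if "{u, v} \<in> edges G" for u v
    using same_block_verts[OF V] agg_graph_edgeD[OF assms that] by blast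
  with V show ?thesis by (auto simp: compatible_def)
qed

text \<open>A block strictly larger than a vertex \<open>v\<close> would contain a second vertex
  \<open>w\<close>, although the edge \<open>{v, w}\<close> separates them.\<close>

lemma compatible_complete:
  assumes G: "agg_graph S G" and "complete_graph G"
  shows "compatible S G = {verts G}"
proof -
  have V: "partition_on S (verts G)" using G by (simp add: agg_graph_def)
  have "P = verts G" if "P \<in> compatible S G" for P
  proof -
    from that have P: "partition_on S P" "\<And>v. v \<in> verts G \<Longrightarrow> \<exists>B\<in>P. v \<subseteq> B"
      "\<And>u v. {u, v} \<in> edges G \<Longrightarrow> \<not> same_block P u v" by (auto simp: compatible_def)
    have eq: "v = B" if vB: "v \<in> verts G" "B \<in> P" "v \<subseteq> B" for v B
    proof (rule ccontr)
      assume "v \<noteq> B"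
      with vB obtain b where b: "b \<in> B" "b \<notin> v" by blast
      with vB P(1) V obtain w where w: "w \<in> verts G" "b \<in> w"
        unfolding partition_on_def by blast
      obtain B' where B': "B' \<in> P" "w \<subseteq> B'" using P(2) w by blast
      with b w vB have "B' = B" using partition_block_eq[OF P(1)] by blast
      with B' vB have "same_block P v w" by (auto simp: same_block_def)
      moreover have "{v, w} \<in> edges G"
        using assms(2) vB w b unfolding complete_graph_def by blast
      ultimately show False using P(3) by blast
    qed
    show ?thesis
    proof
      show "verts G \<subseteq> P" using P(2) eq by blast
      show "P \<subseteq> verts G"
      proof
        fix B assume B: "B \<in> P"
        with P(1) obtain b where b: "b \<in> B" "b \<in> S" by (rule partition_block_nonempty)
        from V b(2) obtain v where v: "v \<in> verts G" "b \<in> v" by (rule partition_block_of)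
        obtain B' where B': "B' \<in> P" "v \<subseteq> B'" using P(2) v by blast
        with b v B have "B' = B" using partition_block_eq[OF P(1)] by blast
        with eq v B' show "B \<in> verts G" by blast
      qed
    qed
  qed
  with verts_compatible[OF G] show ?thesis by blast
qed

lemma same_block_commute: "same_block P u v = same_block P v u"
  by (auto simp: same_block_def)

lemma compatible_add_edge:
  "compatible S (add_edge x y G) = {P \<in> compatible S G. \<not> same_block P x y}"
  by (auto simp: compatible_def doubleton_eq_iff same_block_commute)

lemma compatible_merge:
  assumes G: "agg_graph S G" and x: "x \<in> verts G" and y: "y \<in> verts G" and xy: "x \<noteq> y"
    and nonadj: "{x, y} \<notin> edges G"
  shows "compatible S (merge x y G) = {P \<in> compatible S G. same_block P x y}"
proof (intro set_eqI iffI)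
  fix P assume "P \<in> compatible S (merge x y G)"
  then have P: "partition_on S P" and V: "\<And>v. v \<in> verts (merge x y G) \<Longrightarrow> \<exists>B\<in>P. v \<subseteq> B"
    and E: "\<And>u v. {u, v} \<in> edges (merge x y G) \<Longrightarrow> \<not> same_block P u v"
    by (auto simp: compatible_def)
  obtain B where B: "B \<in> P" "x \<union> y \<subseteq> B" using V[of "x \<union> y"] by (auto simp: merge_def)
  have ne: "x \<noteq> {}" "y \<noteq> {}" using G x y unfolding agg_graph_def partition_on_def by auto
  have blk: "B' = B" if "B' \<in> P" "x \<subseteq> B' \<or> y \<subseteq> B'" for B'
    using that B P ne unfolding partition_on_def disjoint_def by blast
  \<comment> \<open>An edge at \<open>x\<close> or \<open>y\<close> is inherited by the merged
    vertex, whose block \<open>B\<close> is the only one containing \<open>x\<close> or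
    \<open>y\<close>.\<close>
  have *: "\<not> same_block P w v" if e: "{w, v} \<in> edges G" and w: "w \<in> {x, y}" for w v
  proof
    assume "same_block P w v"
    then obtain B' where B': "B' \<in> P" "w \<subseteq> B'" "v \<subseteq> B'" by (auto simp: same_block_def)
    with blk w have "v \<subseteq> B" by auto
    with B have "same_block P (x \<union> y) v" by (auto simp: same_block_def)
    moreover have "v \<in> verts G" "v \<notin> {x, y}"
      using agg_graph_edgeD[OF G e] w nonadj e by (auto simp: insert_commute)
    then have "{x \<union> y, v} \<in> edges (merge x y G)"
      using e w by (auto simp: merge_def)
    ultimately show False using E by blast
  qed
  have "\<not> same_block P u v" if e: "{u, v} \<in> edges G" for u v
  proof (cases "u \<in> {x, y} \<or> v \<in> {x, y}")
    case True
    then show ?thesis using * e by (metis insert_commute same_block_commute)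
  next
    case False
    with e have "{u, v} \<in> edges (merge x y G)" by (auto simp: merge_def)
    with E show ?thesis by blast
  qed
  moreover have "\<exists>B\<in>P. v \<subseteq> B" if "v \<in> verts G" for v
    using V[of v] B that by (cases "v \<in> {x, y}") (auto simp: merge_def)
  ultimately show "P \<in> {P \<in> compatible S G. same_block P x y}"
    using P B by (auto simp: compatible_def same_block_def)
next
  fix P assume "P \<in> {P \<in> compatible S G. same_block P x y}"
  then have P: "partition_on S P" and V: "\<And>v. v \<in> verts G \<Longrightarrow> \<exists>B\<in>P. v \<subseteq> B"
    and E: "\<And>u v. {u, v} \<in> edges G \<Longrightarrow> \<not> same_block P u v" and s: "same_block P x y"
    by (auto simp: compatible_def)
  have *: "\<not> same_block P (x \<union> y) z" if "{x, z} \<in> edges G \<or> {y, z} \<in> edges G" for z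
    using that E unfolding same_block_def by (metis le_sup_iff)
  have "\<not> same_block P u v" if "{u, v} \<in> edges (merge x y G)" for u v
    using that * E by (auto simp: merge_def doubleton_eq_iff same_block_commute)
  moreover have "\<exists>B\<in>P. v \<subseteq> B" if "v \<in> verts (merge x y G)" for v
    using that V s by (auto simp: merge_def same_block_def)
  ultimately show "P \<in> compatible S (merge x y G)"
    using P by (auto simp: compatible_def)
qed

section \<open>Induction over the decision tree\<close>

text \<open>The chordality condition restricted to inputs that can still occur at \<open>G\<close>,
  so that it passes to both subtrees.\<close>

definition chordal_runs :: "'a set \<Rightarrow> 'a agg_graph \<Rightarrow> 'a ac_tree \<Rightarrow> bool" where
  "chordal_runs S G T \<longleftrightarrow> (\<forall>P\<in>compatible S G. \<forall>H\<in>set (run P G T). chordal_graph H)"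

lemma chordal_runs_chordal:
  assumes "agg_graph S G" "chordal_runs S G T"
  shows "chordal_graph G"
proof -
  have "G \<in> set (run (verts G) G T)" by (cases T) auto
  with assms verts_compatible show ?thesis unfolding chordal_runs_def by blast
qed

text \<open>The clique counts are carried along because they determine \<open>D\<close>: this lets
  the multisets of the two subtrees be compared, and later those of two algorithms.\<close>

lemma gen_fun_runs:
  assumes "finite S" "agg_graph S G" "admissible G T" "chordal_runs S G T"
  shows "\<exists>D. (\<forall>k. card (cliques G (Suc k)) = binom_sum D k) \<and>
    (\<forall>q>0. (\<Sum>P\<in>compatible S G. q ^ complexity P T) = gen_fun q D 0)"
  using assms(2-)
proof (induction T arbitrary: G)
  case Stop
  then have "finite (verts G)" using assms(1)
    by (meson agg_graph_def finite_elements)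
  with Stop have "card (cliques G (Suc k)) = binom_sum (mset [0..<card (verts G)]) k" for k
    by (simp add: card_cliques_complete binom_sum_upt del: mset_upt)
  moreover have "(\<Sum>P\<in>compatible S G. q ^ complexity P Stop) = gen_fun q (mset [0..<card (verts G)]) 0"
    if "q > 0" for q
    using Stop that by (simp add: compatible_complete gen_fun_upt del: mset_upt)
  ultimately show ?case by blast
next
  case (Query x y N Y)
  let ?A = "add_edge x y G" and ?M = "merge x y G"
  have fin: "finite (verts G)" using assms(1) Query.prems(1)
    by (meson agg_graph_def finite_elements)
  have xy: "x \<in> verts G" "y \<in> verts G" "x \<noteq> y" "{x, y} \<notin> edges G"
    and adm: "admissible ?A N" "admissible ?M Y" using Query.prems(2) by auto
  note aA = agg_graph_add_edge[OF Query.prems(1) xy(1-3)]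
    and aM = agg_graph_merge[OF Query.prems(1) xy(1-3)]
  note cA = compatible_add_edge[of S x y G]
    and cM = compatible_merge[OF Query.prems(1) xy]
  have rA: "chordal_runs S ?A N" and rM: "chordal_runs S ?M Y"
    using Query.prems(3) unfolding chordal_runs_def cA cM by auto
  note ch = chordal_runs_chordal[OF Query.prems(1) Query.prems(3)]
    and chA = chordal_runs_chordal[OF aA rA]
  from Query.IH(1)[OF aA adm(1) rA] obtain D where
    D: "\<And>k. card (cliques ?A (Suc k)) = binom_sum D k"
    "\<And>q. q > 0 \<Longrightarrow> (\<Sum>P\<in>compatible S ?A. q ^ complexity P N) = gen_fun q D 0" by blast
  from Query.IH(2)[OF aM adm(2) rM] obtain E where
    E: "\<And>k. card (cliques ?M (Suc k)) = binom_sum E k"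
    "\<And>q. q > 0 \<Longrightarrow> (\<Sum>P\<in>compatible S ?M. q ^ complexity P Y) = gen_fun q E 0" by blast
  define c where "c = card (nbrs G x \<inter> nbrs G y)"
  have cliques_G: "card (cliques G (Suc k)) = binom_sum (add_mset c E) k" for k
    using card_cliques_merge[OF fin Query.prems(1) xy ch chA] E(1) by (simp add: c_def)
  \<comment> \<open>Both counting lemmas express the counts of \<open>G\<close>; eliminating these
    relates \<open>D\<close> to \<open>E\<close>, and injectivity turns equal sums into equal
    multisets. This makes the recursion \<open>gen_fun_query\<close> applicable.\<close>
  have DE: "D = add_mset (Suc c) E"
  proof (rule binom_sum_inject)
    fix k
    show "binom_sum D k = binom_sum (add_mset (Suc c) E) k"
      using card_cliques_add_edge[OF fin Query.prems(1) xy ch, of k] D(1)[of k] cliques_G[of k]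
      by (simp add: c_def)
  qed
  have "(\<Sum>P\<in>compatible S G. q ^ complexity P (Query x y N Y)) = gen_fun q (add_mset c E) 0"
    if q: "q > 0" for q
  proof -
    have "compatible S G = compatible S ?A \<union> compatible S ?M"
      unfolding cA cM by auto
    then have "(\<Sum>P\<in>compatible S G. q ^ complexity P (Query x y N Y))
      = (\<Sum>P\<in>compatible S ?A. q ^ complexity P (Query x y N Y))
        + (\<Sum>P\<in>compatible S ?M. q ^ complexity P (Query x y N Y))"
      by (simp only:) (rule sum.union_disjoint; use assms(1) in \<open>auto simp: finite_compatible cA cM\<close>)
    also have "(\<Sum>P\<in>compatible S ?A. q ^ complexity P (Query x y N Y))
      = q * (\<Sum>P\<in>compatible S ?A. q ^ complexity P N)"
      by (simp add: sum_distrib_left cA)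
    also have "(\<Sum>P\<in>compatible S ?M. q ^ complexity P (Query x y N Y))
      = q * (\<Sum>P\<in>compatible S ?M. q ^ complexity P Y)"
      by (simp add: sum_distrib_left cM)
    finally show ?thesis
      using gen_fun_query[OF q, of c E 0] D(2)[OF q] E(2)[OF q] DE by (simp add: distrib_left)
  qed
  with cliques_G show ?case by blast
qed

text \<open>The difference of the two sums is a polynomial in \<open>q\<close> vanishing at every
  positive \<open>q\<close>, so all its coefficients are 0.\<close>

lemma card_fibres_eq:
  fixes f g :: "'b \<Rightarrow> nat"
  assumes fin: "finite X"
    and eq: "\<And>q::real. q > 0 \<Longrightarrow> (\<Sum>a\<in>X. q ^ f a) = (\<Sum>a\<in>X. q ^ g a)"
  shows "card {a \<in> X. f a = i} = card {a \<in> X. g a = i}"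
proof -
  \<comment> \<open>Inserting \<open>i\<close> puts the wanted coefficient within the degree bound
    and keeps the set nonempty.\<close>
  define m where "m = Max (insert i (f ` X \<union> g ` X))"
  have m: "i \<le> m" "\<And>a. a \<in> X \<Longrightarrow> f a \<le> m" "\<And>a. a \<in> X \<Longrightarrow> g a \<le> m"
    using fin by (auto simp: m_def)
  have sum: "(\<Sum>a\<in>X. q ^ h a) = (\<Sum>j\<le>m. real (card {a \<in> X. h a = j}) * q ^ j)"
    if "\<And>a. a \<in> X \<Longrightarrow> h a \<le> m" for h and q :: real
  proof -
    have "(\<Sum>j\<le>m. real (card {a \<in> X. h a = j}) * q ^ j) = (\<Sum>j\<le>m. \<Sum>a | a \<in> X \<and> h a = j. q ^ h a)"
      by (intro sum.cong) auto
    also have "\<dots> = (\<Sum>a\<in>X. q ^ h a)"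
      using that fin by (intro sum.group) auto
    finally show ?thesis by simp
  qed
  let ?c = "\<lambda>j. real (card {a \<in> X. f a = j}) - real (card {a \<in> X. g a = j})"
  have "{0<..} \<subseteq> {q::real. (\<Sum>j\<le>m. ?c j * q ^ j) = 0}"
    using eq sum[of f] sum[of g] m by (auto simp: left_diff_distrib sum_subtractf)
  then have "infinite {q::real. (\<Sum>j\<le>m. ?c j * q ^ j) = 0}"
    using infinite_Ioi finite_subset by blast
  then have "\<forall>j\<le>m. ?c j = 0"
    using polyfun_finite_roots[of ?c m] by blast
  with m(1) show ?thesis by simp
qed

theorem theorem2:
  fixes S :: "'a set" and n :: nat and A B :: "'a ac_tree"
  assumes "n \<ge> 1" and "finite S" and "card S = n"
    and "chordal_algorithm S A" and "chordal_algorithm S B"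
  shows "\<forall>i. complexity_distribution S A i = complexity_distribution S B i"
proof
  fix i
  let ?G = "initial_graph S"
  have "\<exists>D. (\<forall>k. card (cliques ?G (Suc k)) = binom_sum D k) \<and>
      (\<forall>q>0. (\<Sum>P\<in>compatible S ?G. q ^ complexity P T) = gen_fun q D 0)"
    if "chordal_algorithm S T" for T
    using that assms(2) agg_graph_initial
    by (intro gen_fun_runs)
      (auto simp: chordal_algorithm_def ac_algorithm_def chordal_runs_def compatible_initial)
  then obtain D E where
    D: "\<And>k. card (cliques ?G (Suc k)) = binom_sum D k"
      "\<And>q. q > 0 \<Longrightarrow> (\<Sum>P\<in>compatible S ?G. q ^ complexity P A) = gen_fun q D 0" and
    E: "\<And>k. card (cliques ?G (Suc k)) = binom_sum E k"
      "\<And>q. q > 0 \<Longrightarrow> (\<Sum>P\<in>compatible S ?G. q ^ complexity P B) = gen_fun q E 0"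
    using assms(4,5) by metis
  \<comment> \<open>The two algorithms meet here: both multisets have the clique counts of the same
    initial graph.\<close>
  have "D = E" using D(1) E(1) by (intro binom_sum_inject) simp
  with D(2) E(2) have "card {P \<in> compatible S ?G. complexity P A = i}
      = card {P \<in> compatible S ?G. complexity P B = i}"
    by (intro card_fibres_eq finite_compatible assms(2)) simp
  then show "complexity_distribution S A i = complexity_distribution S B i"
    by (simp add: complexity_distribution_def compatible_initial)
qed

end
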